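(* Let $r$ be a non-negative integer, $m$ a positive integer, $n=2m+1$ and $1\le j\le m$. Then $$\mathscr{F}_{-r}^{(m,j)}=n\sum_{a=-\infty}^{\infty}(-1)^{r+j+a}\binom{2r+1}{r+j+an}=n\,\mathfrak{F}(2r+1,\,(r+j)\ (\bmod\ n)),$$ $$\mathscr{G}_{-r}^{(m,j)}=n\sum_{a=-\infty}^{\infty}(-1)^{r+j+1+a}\binom{2r+2}{r+j+1+an}=n\,\mathfrak{F}(2r+2,\,(r+j+1)\ (\bmod\ n)).$$ Hence, when $n=p^\alpha$ is a prime power, they satisfy an analogue of Weisman's congruence: $\frac1n\mathscr{F}_{-r}^{(m,j)}\equiv0\pmod{p^{\omega}}$ with $\omega=\left\lfloor\frac{2r+1-p^{\alpha-1}}{p^\alpha-p^{\alpha-1}}\right\rfloor$ if $2r+1\ge p^{\alpha-1}$, and $\frac1n\mathscr{G}_{-r}^{(m,j)}\equiv0\pmod{p^{\omega'}}$ with $\omega'=\left\lfloor\frac{2r+2-p^{\alpha-1}}{p^\alpha-p^{\alpha-1}}\right\rfloor$ if $2r+2\ge p^{\alpha-1}$. Moreover $$n\,\mathfrak{F}(2r+1,\,(r+j)\ (\bmod\ n))=\sum_{t=1}^m\mu_{m\,t}^{r+1}P_{j-1}(\mu_{m\,t})=\sum_{t=1}^m\mu_{m\,t}^{r+1}V_{j-1}(\phi_{m\,t})=\sum_{t=1}^m\mu_{m\,t}^{r}\left(\phi_{m\,jt}-\phi_{m\,(j-1)t}\right),$$ and similarly $$n\,\mathfrak{F}(2r+2,\,(r+j+1)\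 (\bmod\ n))=\sum_{t=1}^m\mu_{m\,t}^{r+1}Q_j(\mu_{m\,t})=\sum_{t=1}^m\mu_{m\,t}^{r}\left(\phi_{m\,(j+1)t}-2\phi_{m\,jt}+\phi_{m\,(j-1)t}\right).$$
   Context: Fleck numbers: $\mathfrak{F}(N,a\ (\bmod\ n))=\sum_{k\equiv a\ (\mathrm{mod}\ n)}(-1)^k\binom Nk$; binomial coefficients $\binom{N}{k}$ with $k<0$ or $k>N$ are $0$. For all integers $k$ set $\phi_{m\,k}=2\cos\left(\frac{2\pi k}{2m+1}\right)$ and $\mu_{m\,k}=\phi_{m\,k}-2$ (a second index such as $jt$ is a product). For $m\ge0$: $P_m(x)=\sum_{k=0}^{m}\frac{2m+1}{2k+1}\binom{m+k}{2k}x^{k}$, $Q_m(x)=2+\sum_{k=1}^{m}\frac{m}{k}\binom{m+k-1}{2k-1}x^k$, $V_m(x)=\sum_{k=0}^m(-1)^{k+\lfloor (m+k)/2\rfloor}\binom{\lfloor (m+k)/2\rfloor}{k}x^{k}=P_m(x-2)$. Rational interlacing Fibonacci sequences of dimension $m\ge1$. Let $h_k=\frac1{2k+1}\binom{m+k}{2k}$ and let $R_m$ be the $m\times m$ matrix whose first column is $(-h_1,-h_2,\dots,-h_m)^T$, whose entries $(i,i+1)$, $1\le i\le m-1$, equal $1$, and whose other entries are $0$ (it is invertible). Let $B_{\rm odd}$, $B_{\rm even}$ be the $m\times m$ matrices with $(i,j)$ entries $(-1)^{i+j-1}\binom{2j-1}{j-i}$ and $(-1)^{i+j}\binom{2j}{j-i}$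 respectively (binomial coefficients with negative lower entry are $0$). For $r\in\mathbb{Z}$ and $1\le j\le m$, $\mathscr{F}_r^{(m,j)}$ (resp. $\mathscr{G}_r^{(m,j)}$) is the $(j,1)$ entry of $(2m+1)B_{\rm odd}R_m^{r}$ (resp. $(2m+1)B_{\rm even}R_m^{r}$). *)

theory Defs
  imports
    Complex_Main
    "HOL-Library.Groups_Big_Fun"
    "HOL-Number_Theory.Cong"
    "Jordan_Normal_Form.Determinant"
begin

definition binom :: "nat \<Rightarrow> int \<Rightarrow> nat" where
  "binom N k = (if k < 0 then 0 else N choose nat k)"

text \<open>Only the indices from \<open>0\<close> to \<open>N\<close> contribute to a Fleck number,
  so the sum is written over those.\<close>

definition fleck :: "nat \<Rightarrow> int \<Rightarrow> nat \<Rightarrow> int" where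
  "fleck N a n = (\<Sum>k | k \<le> N \<and> [int k = a] (mod int n). (-1) ^ k * int (N choose k))"

text \<open>\<^const>\<open>Sum_any\<close> is a junk value for a function of infinite support; the following
  shows that the sums over all integers in the statement are not of this kind.\<close>

lemma finite_support_binom:
  fixes f :: "int \<Rightarrow> 'a::semiring_1" and c :: int
  assumes "n > 0"
  shows "finite {a. f a * of_nat (binom N (c + a * int n)) \<noteq> 0}"
proof (rule finite_subset)
  show "finite {- \<bar>c\<bar> .. int N + \<bar>c\<bar>}" by simp
  show "{a. f a * of_nat (binom N (c + a * int n)) \<noteq> 0} \<subseteq> {- \<bar>c\<bar> .. int N + \<bar>c\<bar>}"
  proof
    fix a assume "a \<in> {a. f a * of_nat (binom N (c + a * int n)) \<noteq> 0}"
    then have "binom N (c + a * int n) \<noteq> 0" by (auto intro: ccontr)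
    then have lo: "0 \<le> c + a * int n" and hi: "c + a * int n \<le> int N"
      by (auto simp: binom_def split: if_splits intro: ccontr)
    have n: "1 \<le> int n" using assms by simp
    show "a \<in> {- \<bar>c\<bar> .. int N + \<bar>c\<bar>}"
    proof (cases "a \<ge> 0")
      case True
      then have "a * 1 \<le> a * int n" using n by (intro mult_left_mono) auto
      then show ?thesis using True hi by auto
    next
      case False
      then have "a * int n \<le> a * 1" using n by (intro mult_left_mono_neg) auto
      then have "- c \<le> a" using lo by linarith
      then show ?thesis using False by auto
    qed
  qed
qed

definition phi :: "nat \<Rightarrow> int \<Rightarrow> real" where
  "phi m k = 2 * cos (2 * pi * of_int k / (2 * of_nat m + 1))"

definition mu :: "nat \<Rightarrow> int \<Rightarrow> real" where
  "mu m k = phi m k - 2"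

definition P_poly :: "nat \<Rightarrow> real \<Rightarrow> real" where
  "P_poly m x = (\<Sum>k=0..m. (2 * of_nat m + 1) / (2 * of_nat k + 1) * of_nat ((m + k) choose (2 * k)) * x ^ k)"

definition Q_poly :: "nat \<Rightarrow> real \<Rightarrow> real" where
  "Q_poly m x = 2 + (\<Sum>k=1..m. of_nat m / of_nat k * of_nat ((m + k - 1) choose (2 * k - 1)) * x ^ k)"

definition V_poly :: "nat \<Rightarrow> real \<Rightarrow> real" where
  "V_poly m x = (\<Sum>k=0..m. (-1) ^ (k + (m + k) div 2) * of_nat (((m + k) div 2) choose k) * x ^ k)"

text \<open>Matrix indices start at \<open>0\<close> in the library; \<open>mat1\<close> takes the entries indexed from \<open>1\<close>.\<close>

definition mat1 :: "nat \<Rightarrow> (nat \<Rightarrow> nat \<Rightarrow> 'a) \<Rightarrow> 'a mat" where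
  "mat1 m f = mat m m (\<lambda>(i, j). f (Suc i) (Suc j))"

definition entry1 :: "'a mat \<Rightarrow> nat \<Rightarrow> nat \<Rightarrow> 'a" where
  "entry1 A i j = A $$ (i - 1, j - 1)"

definition h_coeff :: "nat \<Rightarrow> nat \<Rightarrow> rat" where
  "h_coeff m k = 1 / (2 * of_nat k + 1) * of_nat ((m + k) choose (2 * k))"

definition R_mat :: "nat \<Rightarrow> rat mat" where
  "R_mat m = mat1 m (\<lambda>i j. if j = 1 then - h_coeff m i else if j = i + 1 then 1 else 0)"

definition B_odd :: "nat \<Rightarrow> rat mat" where
  "B_odd m = mat1 m (\<lambda>i j. (-1) ^ (i + j - 1) * of_nat (binom (2 * j - 1) (int j - int i)))"

definition B_even :: "nat \<Rightarrow> rat mat" where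
  "B_even m = mat1 m (\<lambda>i j. (-1) ^ (i + j) * of_nat (binom (2 * j) (int j - int i)))"

definition mat_powi :: "'a::field mat \<Rightarrow> int \<Rightarrow> 'a mat" where
  "mat_powi A r = (if r \<ge> 0 then A ^\<^sub>m nat r else the (mat_inverse A) ^\<^sub>m nat (- r))"

lemma R_mat_inverse:
  assumes "m \<ge> 1"
  obtains S where "mat_inverse (R_mat m) = Some S" "S \<in> carrier_mat m m"
    "R_mat m * S = 1\<^sub>m m" "S * R_mat m = 1\<^sub>m m"
proof -
  define S where "S = mat m m (\<lambda>(i, j). if j = m - 1
      then (if i = 0 then - 1 / h_coeff m m else - h_coeff m i / h_coeff m m)
      else if i = Suc j then 1 else 0)"
  have S: "S \<in> carrier_mat m m" and R: "R_mat m \<in> carrier_mat m m"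
    by (auto simp: S_def R_mat_def mat1_def)
  have hm: "h_coeff m m \<noteq> 0"
  proof -
    have "2 * of_nat m + 1 = (of_nat (2 * m + 1) :: rat)" by simp
    then have "2 * of_nat m + 1 \<noteq> (0 :: rat)" by (simp only: of_nat_eq_0_iff)
    moreover have "(m + m) choose (2 * m) = 1" by (simp only: mult_2 binomial_n_n)
    ultimately show ?thesis unfolding h_coeff_def by (simp only: of_nat_1) simp
  qed
  have RS: "R_mat m * S = 1\<^sub>m m"
  proof (rule eq_matI)
    fix i j assume "i < dim_row (1\<^sub>m m)" "j < dim_col (1\<^sub>m m)"
    then have ij: "i < m" "j < m" by auto
    have "(R_mat m * S) $$ (i, j) = (\<Sum>k = 0..<m. R_mat m $$ (i, k) * S $$ (k, j))"
      using ij S R by (simp add: scalar_prod_def)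
    also have "\<dots> = (\<Sum>k \<in> {0..<m}. (if k = 0 then - h_coeff m (Suc i) * S $$ (0, j) else 0)
        + (if k = Suc i then S $$ (Suc i, j) else 0))"
      using ij by (intro sum.cong) (auto simp: R_mat_def mat1_def)
    also have "\<dots> = - h_coeff m (Suc i) * S $$ (0, j) + (if Suc i < m then S $$ (Suc i, j) else 0)"
      using assms by (simp add: sum.distrib)
    also have "\<dots> = 1\<^sub>m m $$ (i, j)"
    proof (cases "Suc i < m")
      case True
      then show ?thesis using ij assms hm by (auto simp: S_def)
    next
      case False
      then have "Suc i = m" using ij by simp
      then show ?thesis using ij assms hm by (auto simp: S_def)
    qed
    finally show "(R_mat m * S) $$ (i, j) = 1\<^sub>m m $$ (i, j)" .
  qed (use S R in auto)
  have SR: "S * R_mat m = 1\<^sub>m m" using mat_mult_left_right_inverse[OF R S RS] .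
  have "R_mat m \<in> Units (ring_mat TYPE(rat) m ())"
    using R S RS SR by (auto simp: Units_def ring_mat_simps)
  then obtain T where T: "mat_inverse (R_mat m) = Some T"
    using mat_inverse(1)[OF R, where b = "()"] by (cases "mat_inverse (R_mat m)") auto
  then show ?thesis using mat_inverse(2)[OF R T] that by blast
qed

definition F_seq :: "nat \<Rightarrow> nat \<Rightarrow> int \<Rightarrow> rat" where
  "F_seq m j r = entry1 (of_nat (2 * m + 1) \<cdot>\<^sub>m (B_odd m * mat_powi (R_mat m) r)) j 1"

definition G_seq :: "nat \<Rightarrow> nat \<Rightarrow> int \<Rightarrow> rat" where
  "G_seq m j r = entry1 (of_nat (2 * m + 1) \<cdot>\<^sub>m (B_even m * mat_powi (R_mat m) r)) j 1"

end

theory Submission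
  imports Defs
begin

text \<open>Everything rests on one observation: a Fleck number \<open>fleck N a n\<close> is a coefficient of \<open>(1 - x) ^ N\<close>
in the ring \<open>\<int>[x] / (x ^ n - 1)\<close>.

Evaluating at the \<open>n\<close>-th roots of unity \<open>\<zeta> ^ t\<close> gives the cosine sums. There
\<open>(1 - \<zeta> ^ t)\<^sup>2 = \<zeta> ^ t * \<mu> t\<close>, so that two more factors \<open>1 - x\<close>, combined with a shift of the residue by one,
multiply the \<open>t\<close>-th Fourier coefficient by \<open>\<mu> t\<close>. In real terms this is an induction on \<open>r\<close>: the second
difference of \<open>k \<mapsto> \<phi> (k t)\<close> is \<open>\<mu> t * \<phi> (k t)\<close> (\<open>phi_second_difference\<close>), the second difference of Fleck
numbers is Pascal's rule applied twice, and the start of the induction is the vanishing of the Dirichlet kernel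
(\<open>sum_phi\<close>). The polynomial forms of the sums come from \<open>Q j (\<mu> t) = \<phi> (j t)\<close> and
\<open>x * P j x = Q (j + 1) x - Q j x\<close>.

The same sums produce the matrix powers. The numbers \<open>\<mu> 1, \<dots>, \<mu> m\<close> are roots of \<open>P m\<close>, whose coefficients are
\<open>(2 * m + 1) * h k\<close>; hence both families of Fleck numbers, as sequences in \<open>r\<close>, satisfy the linear recurrence with
coefficients \<open>h 0, \<dots>, h m\<close>. The inverse of \<open>R m\<close> is the companion matrix of this recurrence, so multiplying a row
\<open>(u 0, \<dots>, u (m - 1))\<close> of initial values by its \<open>r\<close>-th power gives \<open>(u r, \<dots>, u (r + m - 1))\<close>
(\<open>window_matrix_times_R_power\<close>). The rows of \<open>B_odd\<close> and \<open>B_even\<close> are precisely such initial values, because for small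
\<open>N\<close> a Fleck number consists of a single binomial coefficient.

Finally, the congruence is a statement about \<open>(1 - x) ^ N\<close> modulo \<open>x ^ n - 1\<close>. For \<open>n = p * q\<close> with
\<open>q\<close> a power of \<open>p\<close>, put \<open>y = 1 - x ^ q\<close>. Modulo \<open>p\<close>, \<open>(1 - x) ^ q\<close> is \<open>y\<close>, and \<open>y ^ p\<close> is a multiple of
\<open>p * y\<close> modulo \<open>x ^ n - 1\<close>. So \<open>(1 - x) ^ q\<close> lies in the ideal \<open>J = (y, p)\<close>, and each further factor
\<open>(1 - x) ^ (q * (p - 1))\<close> maps \<open>J\<close> into \<open>p J\<close> modulo \<open>x ^ n - 1\<close>, which produces one more power of \<open>p\<close>
(\<open>one_minus_power_mod_prime_power\<close>).\<close>

section \<open>Fleck numbers as coefficients modulo x^n - 1\<close>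

text \<open>The coefficient of \<open>x ^ a\<close> in the residue of \<open>f\<close> modulo \<open>x ^ n - 1\<close>.\<close>
definition residue_sum :: "nat \<Rightarrow> int \<Rightarrow> int poly \<Rightarrow> int" where
  "residue_sum n a f = (\<Sum>k | k \<le> degree f \<and> [int k = a] (mod int n). coeff f k)"

text \<open>Summing up to any bound \<open>M\<close> lets polynomials of different degrees be compared.\<close>
lemma residue_sum_eq:
  assumes "degree f \<le> M"
  shows "residue_sum n a f = (\<Sum>k\<le>M. if [int k = a] (mod int n) then coeff f k else 0)"
proof -
  have "(\<Sum>k\<le>M. if [int k = a] (mod int n) then coeff f k else 0)
      = (\<Sum>k | k \<le> M \<and> [int k = a] (mod int n). coeff f k)"
    by (simp add: sum.If_cases Collect_conj_eq atMost_def)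
  also have "\<dots> = residue_sum n a f"
    unfolding residue_sum_def using assms
    by (intro sum.mono_neutral_right) (auto simp: not_le intro: coeff_eq_0)
  finally show ?thesis ..
qed

lemma residue_sum_add: "residue_sum n a (f + g) = residue_sum n a f + residue_sum n a g"
proof -
  have "degree (f + g) \<le> max (degree f) (degree g)"
    by (rule degree_add_le) auto
  then show ?thesis
    by (simp add: residue_sum_eq[where M = "max (degree f) (degree g)"] sum.distrib[symmetric]
        if_distrib cong: if_cong)
qed

lemma residue_sum_smult: "residue_sum n a (smult c f) = c * residue_sum n a f"
  by (simp add: residue_sum_eq[where M = "degree f"] sum_distrib_left if_distrib cong: if_cong)

lemma residue_sum_diff: "residue_sum n a (f - g) = residue_sum n a f - residue_sum n a g"
  using residue_sum_add[of n a f "smult (-1) g"] residue_sum_smult[of n a "-1" g] by simp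

lemma residue_sum_cong: "[a = b] (mod int n) \<Longrightarrow> residue_sum n a f = residue_sum n b f"
  unfolding residue_sum_def by (metis cong_sym cong_trans)

lemma residue_sum_X_mult: "residue_sum n a ([:0, 1:] * f) = residue_sum n (a - 1) f"
proof -
  have "[:0, 1:] * f = pCons 0 f" by simp
  then have "residue_sum n a ([:0, 1:] * f)
      = (\<Sum>k\<le>Suc (degree f). if [int k = a] (mod int n) then coeff (pCons 0 f) k else 0)"
    by (simp only:) (rule residue_sum_eq, rule degree_pCons_le)
  also have "\<dots> = (\<Sum>k\<le>degree f. if [int (Suc k) = a] (mod int n) then coeff f k else 0)"
    by (subst sum.atMost_Suc_shift) (simp cong: if_cong)
  also have "\<dots> = residue_sum n (a - 1) f"
    by (subst residue_sum_eq[OF order_refl]) (simp add: cong_iff_dvd_diff algebra_simps)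
  finally show ?thesis .
qed

lemma residue_sum_X_power_mult:
  "residue_sum n a ([:0, 1:] ^ k * f) = residue_sum n (a - int k) f"
proof (induction k arbitrary: a)
  case (Suc k)
  have "a - 1 - int k = a - int (Suc k)" by simp
  then show ?case by (simp only: power_Suc mult.assoc residue_sum_X_mult Suc)
qed simp

lemma residue_sum_X_power_minus_one_mult:
  "residue_sum n a (([:0, 1:] ^ n - 1) * f) = 0"
proof -
  have "residue_sum n a (([:0, 1:] ^ n - 1) * f) = residue_sum n (a - int n) f - residue_sum n a f"
    by (simp only: left_diff_distrib mult_1 residue_sum_diff residue_sum_X_power_mult)
  also have "residue_sum n (a - int n) f = residue_sum n a f"
    by (rule residue_sum_cong) (simp add: cong_iff_dvd_diff)
  finally show ?thesis by simp
qed

lemma fleck_eq_residue_sum: "fleck N a n = residue_sum n a ((1 - [:0, 1:]) ^ N)"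
proof -
  have eq: "(1 - [:0, 1:] :: int poly) = [:1, -1:]" by (simp add: one_pCons)
  have c: "coeff ([:1, -1:] ^ N) k = (-1) ^ k * int (N choose k)" for k
  proof (induction N arbitrary: k)
    case 0 then show ?case by (cases k) auto
  next
    case (Suc N) then show ?case by (cases k) (auto simp: coeff_pCons algebra_simps)
  qed
  have "degree ([:1, -1:: int:] ^ N) \<le> N" using degree_power_le[of "[:1, -1::int:]" N] by simp
  then show ?thesis
    unfolding eq
    by (subst residue_sum_eq) (simp_all add: c fleck_def sum.If_cases Collect_conj_eq atMost_def)
qed

text \<open>Pascal's rule, which here is just the expansion of \<open>(1 - x) * (1 - x) ^ N\<close>.\<close>
lemma fleck_Suc: "fleck (Suc N) a n = fleck N a n - fleck N (a - 1) n"
  by (simp only: fleck_eq_residue_sum power_Suc left_diff_distrib mult_1 residue_sum_diff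
      residue_sum_X_mult)

lemma fleck_0: "fleck 0 a n = (if int n dvd a then 1 else 0)"
proof -
  have "{k. k \<le> 0 \<and> [int k = a] (mod int n)} = (if int n dvd a then {0} else {})"
    by (auto simp: cong_iff_dvd_diff)
  then show ?thesis by (simp add: fleck_def)
qed

text \<open>The indices congruent to \<open>a\<close> are \<open>n\<close> apart, so only \<open>a\<close> itself fits below \<open>n\<close>.\<close>
lemma fleck_single_term:
  assumes "N < n" "a < n"
  shows "fleck N (int a) n = (-1) ^ a * int (N choose a)"
proof -
  have "fleck N (int a) n = (\<Sum>k | k \<le> N \<and> k = a. (-1) ^ k * int (N choose k))"
    unfolding fleck_def using assms
    by (intro sum.cong) (auto simp: cong_int_iff dest: cong_less_modulus_unique_nat)
  also have "\<dots> = (\<Sum>k\<in>(if a \<le> N then {a} else {}). (-1) ^ k * int (N choose k))"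
    by (rule sum.cong) auto
  finally show ?thesis by (simp add: binomial_eq_0 split: if_splits)
qed

lemma minus_one_power_int: "(-1 :: rat) powi z = (if even z then 1 else -1)"
  by (simp add: power_int_minus_left)

text \<open>The substitution \<open>k = c + a * n\<close>; since \<open>n\<close> is odd, \<open>k\<close> and \<open>c + a\<close> have the same parity.\<close>
lemma Sum_any_binom_eq_fleck:
  assumes "odd n"
  shows "Sum_any (\<lambda>a::int. (-1) powi (c + a) * of_nat (binom N (c + a * int n)))
    = (of_int (fleck N c n) :: rat)"
proof -
  define A where "A = {a. 0 \<le> c + a * int n \<and> c + a * int n \<le> int N}"
  have n: "n > 0" using assms by (auto intro: Nat.gr0I)
  have inj: "inj_on (\<lambda>a. c + a * int n) A" using n by (auto simp: inj_on_def)
  have fin: "finite A"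
    by (rule inj_on_finite[OF inj, of "{0..int N}"]) (auto simp: A_def)
  have "Sum_any (\<lambda>a::int. (-1) powi (c + a) * of_nat (binom N (c + a * int n)))
      = (\<Sum>a\<in>A. (-1) powi (c + a) * of_nat (binom N (c + a * int n)) :: rat)"
    by (rule Sum_any.expand_superset[OF fin]) (auto simp: A_def binom_def split: if_splits)
  also have "\<dots> = (\<Sum>k | k \<le> N \<and> [int k = c] (mod int n). (-1) ^ k * of_nat (N choose k))"
  proof (rule sum.reindex_bij_witness[where j = "\<lambda>a. nat (c + a * int n)"
        and i = "\<lambda>k. (int k - c) div int n"])
    fix k assume "k \<in> {k. k \<le> N \<and> [int k = c] (mod int n)}"
    then have k: "k \<le> N" "int n dvd int k - c" by (auto simp: cong_iff_dvd_diff)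
    then show "nat (c + (int k - c) div int n * int n) = k" by simp
    show "(int k - c) div int n \<in> A" using k by (simp add: A_def)
  next
    fix a assume a: "a \<in> A"
    then show "(int (nat (c + a * int n)) - c) div int n = a"
      using n by (simp add: A_def)
    show "nat (c + a * int n) \<in> {k. k \<le> N \<and> [int k = c] (mod int n)}"
      using a by (auto simp: A_def cong_iff_dvd_diff)
    have "even (nat (c + a * int n)) \<longleftrightarrow> even (c + a)"
      using a assms by (simp add: A_def even_nat_iff)
    then show "(-1) ^ nat (c + a * int n) * of_nat (N choose nat (c + a * int n))
        = (-1) powi (c + a) * (of_nat (binom N (c + a * int n)) :: rat)"
      using a by (simp add: minus_one_power_int A_def binom_def minus_one_power_iff)
  qed
  also have "\<dots> = of_int (fleck N c n)" by (simp add: fleck_def)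
  finally show ?thesis .
qed

section \<open>Recurrences for the polynomials P, Q and V\<close>

text \<open>\<open>P\<close> and \<open>Q\<close> are sums of two consecutive Morgan-Voyce polynomials. Those obey Pascal's rule coefficientwise,
which gives the three-term recurrences without any manipulation of the fractional coefficients.\<close>

lemma sum_extend_zeros:
  fixes f :: "nat \<Rightarrow> 'a::comm_monoid_add"
  assumes "\<And>k. k > m \<Longrightarrow> f k = 0" "m \<le> M"
  shows "(\<Sum>k=0..m. f k) = (\<Sum>k\<le>M. f k)"
  using assms by (intro sum.mono_neutral_left) auto

definition morgan_voyce_b :: "nat \<Rightarrow> real \<Rightarrow> real" where
  "morgan_voyce_b m x = (\<Sum>k=0..m. of_nat ((m + k) choose (2 * k)) * x ^ k)"

definition morgan_voyce_B :: "nat \<Rightarrow> real \<Rightarrow> real" where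
  "morgan_voyce_B m x = (\<Sum>k=0..m. of_nat ((m + k + 1) choose (2 * k + 1)) * x ^ k)"

lemma morgan_voyce_b_extend: "m \<le> M \<Longrightarrow> morgan_voyce_b m x = (\<Sum>k\<le>M. of_nat ((m + k) choose (2 * k)) * x ^ k)"
  unfolding morgan_voyce_b_def by (rule sum_extend_zeros) (auto simp: binomial_eq_0)

lemma morgan_voyce_B_extend:
  "m \<le> M \<Longrightarrow> morgan_voyce_B m x = (\<Sum>k\<le>M. of_nat ((m + k + 1) choose (2 * k + 1)) * x ^ k)"
  unfolding morgan_voyce_B_def by (rule sum_extend_zeros) (auto simp: binomial_eq_0)

lemma morgan_voyce_b_Suc: "morgan_voyce_b (Suc m) x = morgan_voyce_b m x + x * morgan_voyce_B m x"
proof -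
  have "x * morgan_voyce_B m x = (\<Sum>k\<le>m. of_nat ((m + k + 1) choose (2 * k + 1)) * x ^ Suc k)"
    by (simp add: morgan_voyce_B_extend[OF order_refl] sum_distrib_left mult.left_commute)
  moreover have "morgan_voyce_b m x = 1 + (\<Sum>k\<le>m. of_nat ((m + Suc k) choose (2 * Suc k)) * x ^ Suc k)"
    by (subst morgan_voyce_b_extend[of m "Suc m"])
      (simp add: sum.atMost_Suc_shift del: sum.atMost_Suc, simp only: sum.atMost_Suc_shift, simp)
  ultimately have "morgan_voyce_b m x + x * morgan_voyce_B m x = 1 + (\<Sum>k\<le>m.
      of_nat ((m + Suc k) choose (2 * Suc k)) * x ^ Suc k
      + of_nat ((m + k + 1) choose (2 * k + 1)) * x ^ Suc k)"
    by (simp only: sum.distrib add.assoc)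
  also have "\<dots> = 1 + (\<Sum>k\<le>m. of_nat ((Suc m + Suc k) choose (2 * Suc k)) * x ^ Suc k)"
    by (simp add: algebra_simps)
  also have "\<dots> = morgan_voyce_b (Suc m) x"
    by (simp only: morgan_voyce_b_extend[OF order_refl] sum.atMost_Suc_shift) simp
  finally show ?thesis ..
qed

lemma morgan_voyce_B_Suc: "morgan_voyce_B (Suc m) x = morgan_voyce_B m x + morgan_voyce_b (Suc m) x"
  by (simp add: morgan_voyce_B_extend[of _ "Suc m"] morgan_voyce_b_extend[of _ "Suc m"] sum.distrib[symmetric]
      del: sum.atMost_Suc) (simp add: algebra_simps)

lemma morgan_voyce_b_Suc_Suc: "morgan_voyce_b (Suc (Suc m)) x = (x + 2) * morgan_voyce_b (Suc m) x - morgan_voyce_b m x"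
  by (simp add: morgan_voyce_b_Suc[of "Suc m"] morgan_voyce_B_Suc morgan_voyce_b_Suc[of m] algebra_simps)

text \<open>Absorption turns both binomial coefficients on the right into multiples of \<open>(m + k) choose (2 * k)\<close>, with factors
\<open>m + k + 1\<close> and \<open>m - k\<close> over \<open>2 * k + 1\<close>; these add up to \<open>2 * m + 1\<close>. In particular the
coefficients of \<open>P m\<close> are integers.\<close>
lemma P_coeff_eq:
  "(2 * of_nat m + 1) / (2 * of_nat k + 1) * of_nat ((m + k) choose (2 * k))
    = (of_nat (((m + k + 1) choose (2 * k + 1)) + ((m + k) choose (2 * k + 1))) :: 'a::field_char_0)"
proof -
  have nz: "(of_nat (2 * k + 1) :: 'a) \<noteq> 0" by (simp only: of_nat_eq_0_iff)
  have "(2 * k + 1) * (((m + k + 1) choose (2 * k + 1)) + ((m + k) choose (2 * k + 1)))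
      = (2 * m + 1) * ((m + k) choose (2 * k))"
    using Suc_times_binomial[of "2 * k" "m + k"] by (simp add: algebra_simps)
  then have "(of_nat (2 * k + 1) :: 'a)
        * of_nat (((m + k + 1) choose (2 * k + 1)) + ((m + k) choose (2 * k + 1)))
      = of_nat (2 * m + 1) * of_nat ((m + k) choose (2 * k))"
    by (simp only: of_nat_mult[symmetric])
  moreover have k: "2 * of_nat k + 1 = (of_nat (2 * k + 1) :: 'a)"
    and m: "2 * of_nat m + 1 = (of_nat (2 * m + 1) :: 'a)" by simp_all
  ultimately show ?thesis
    unfolding k m times_divide_eq_left nonzero_divide_eq_eq[OF nz] by (simp only: mult.commute)
qed

lemma Q_coeff_eq:
  assumes "k \<ge> 1"
  shows "of_nat (Suc m) / of_nat k * of_nat ((Suc m + k - 1) choose (2 * k - 1))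
    = (of_nat (((Suc m + k) choose (2 * k)) + ((m + k) choose (2 * k))) :: 'a::field_char_0)"
proof -
  obtain l where l: "k = Suc l" using assms by (cases k) auto
  have "2 * (k * (((Suc m + k) choose (2 * k)) + ((m + k) choose (2 * k))))
      = 2 * (Suc m * ((Suc m + k - 1) choose (2 * k - 1)))"
    using Suc_times_binomial[of "2 * l + 1" "m + k"] by (simp add: l algebra_simps)
  then have "k * (((Suc m + k) choose (2 * k)) + ((m + k) choose (2 * k)))
      = Suc m * ((Suc m + k - 1) choose (2 * k - 1))" by simp
  then have "(of_nat k :: 'a) * of_nat (((Suc m + k) choose (2 * k)) + ((m + k) choose (2 * k)))
      = of_nat (Suc m) * of_nat ((Suc m + k - 1) choose (2 * k - 1))"
    by (simp only: of_nat_mult[symmetric])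
  moreover have "(of_nat k :: 'a) \<noteq> 0" using assms by simp
  ultimately show ?thesis by (simp only: times_divide_eq_left divide_eq_eq mult.commute) simp
qed

lemma Q_poly_0: "Q_poly 0 x = 2"
  by (simp add: Q_poly_def)

lemma Q_poly_Suc: "Q_poly (Suc m) x = morgan_voyce_b (Suc m) x + morgan_voyce_b m x"
proof -
  have "morgan_voyce_b (Suc m) x + morgan_voyce_b m x = (\<Sum>k\<le>Suc m.
      of_nat (((Suc m + k) choose (2 * k)) + ((m + k) choose (2 * k))) * x ^ k)"
    by (simp add: morgan_voyce_b_extend[of _ "Suc m"] sum.distrib[symmetric] distrib_right
        del: sum.atMost_Suc)
  also have "{..Suc m} = insert 0 {1..Suc m}" by auto
  also have "(\<Sum>k\<in>insert 0 {1..Suc m}.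
      of_nat (((Suc m + k) choose (2 * k)) + ((m + k) choose (2 * k))) * x ^ k)
    = 2 + (\<Sum>k=1..Suc m.
      of_nat (((Suc m + k) choose (2 * k)) + ((m + k) choose (2 * k))) * x ^ k)"
    by simp
  also have "\<dots> = Q_poly (Suc m) x"
    unfolding Q_poly_def
    by (intro arg_cong2[where f = "(+)"] sum.cong refl) (simp only: Q_coeff_eq atLeastAtMost_iff)
  finally show ?thesis ..
qed

lemma Q_poly_Suc_Suc: "Q_poly (Suc (Suc m)) x = (x + 2) * Q_poly (Suc m) x - Q_poly m x"
proof (cases m)
  case 0
  then show ?thesis
    by (simp add: Q_poly_Suc Q_poly_0 morgan_voyce_b_Suc_Suc) (simp add: morgan_voyce_b_def algebra_simps)
next
  case (Suc l)
  then show ?thesis by (simp add: Q_poly_Suc morgan_voyce_b_Suc_Suc algebra_simps)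
qed

text \<open>With \<open>P m = B m + B (m - 1)\<close>, this is \<open>x * B m x = b (m + 1) x - b m x\<close> used twice.\<close>
lemma mult_P_poly: "x * P_poly m x = Q_poly (Suc m) x - Q_poly m x"
proof -
  have P: "P_poly m x = (\<Sum>k\<le>m. (of_nat ((m + k + 1) choose (2 * k + 1))
     + of_nat ((m + k) choose (2 * k + 1))) * x ^ k)"
    unfolding P_poly_def P_coeff_eq by (simp add: atMost_atLeast0)
  show ?thesis
  proof (cases m)
    case 0
    then show ?thesis by (simp add: P_poly_def Q_poly_0 Q_poly_Suc morgan_voyce_b_def numeral_2_eq_2)
  next
    case (Suc l)
    have "P_poly m x = morgan_voyce_B m x + morgan_voyce_B l x"
      unfolding P unfolding Suc
      by (simp add: morgan_voyce_B_extend[of _ "Suc l"] sum.distrib[symmetric] distrib_right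
           del: sum.atMost_Suc binomial_Suc_Suc)
    then show ?thesis by (simp add: Suc Q_poly_Suc morgan_voyce_b_Suc algebra_simps)
  qed
qed

text \<open>Raising \<open>m\<close> by two raises \<open>(m + k) div 2\<close> by one, so the recurrence is Pascal's rule for the
coefficients; the exponent \<open>k + (m + k) div 2\<close> of the sign also grows by one, which produces the minus sign.\<close>
lemma V_poly_Suc_Suc: "V_poly (Suc (Suc m)) x = x * V_poly (Suc m) x - V_poly m x"
proof -
  define v where "v l k = (-1) ^ (k + (l + k) div 2) * real (((l + k) div 2) choose k)" for l k :: nat
  have V: "V_poly l x = (\<Sum>k\<le>M. v l k * x ^ k)" if "l \<le> M" for l M
    unfolding V_poly_def v_def using that
    by (intro sum_extend_zeros) (auto simp: binomial_eq_0)
  have v0: "v (Suc (Suc m)) 0 = - v m 0" by (simp add: v_def)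
  have vS: "v (Suc (Suc m)) (Suc k) = v (Suc m) k - v m (Suc k)" for k
    by (simp add: v_def algebra_simps)
  have "x * V_poly (Suc m) x = (\<Sum>k\<le>Suc m. v (Suc m) k * x ^ Suc k)"
    by (simp add: V[OF order_refl] sum_distrib_left mult.left_commute del: sum.atMost_Suc)
  moreover have "V_poly m x = v m 0 + (\<Sum>k\<le>Suc m. v m (Suc k) * x ^ Suc k)"
    by (subst V[of m "Suc (Suc m)"]) (simp_all add: sum.atMost_Suc_shift del: sum.atMost_Suc)
  moreover have "V_poly (Suc (Suc m)) x
      = v (Suc (Suc m)) 0 + (\<Sum>k\<le>Suc m. v (Suc (Suc m)) (Suc k) * x ^ Suc k)"
    by (subst V[OF order_refl]) (simp_all add: sum.atMost_Suc_shift del: sum.atMost_Suc)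
  ultimately show ?thesis
    by (simp only: v0 vS left_diff_distrib sum_subtractf)
qed

text \<open>The difference \<open>Q (m + 1) - Q m\<close>, which equals \<open>(x - 2) * P m (x - 2)\<close> at the argument \<open>x - 2\<close>, satisfies the recurrence
of \<open>V\<close>. The factor \<open>x - 2\<close> is cancelled at the end, whence the assumption.\<close>
lemma V_poly_eq_P_poly:
  assumes "x \<noteq> 2"
  shows "V_poly m x = P_poly m (x - 2)"
proof -
  have "(x - 2) * V_poly m x = Q_poly (Suc m) (x - 2) - Q_poly m (x - 2)"
  proof (induction m rule: induct_nat_012)
    case 0
    show ?case by (simp add: V_poly_def Q_poly_0 Q_poly_Suc morgan_voyce_b_def numeral_2_eq_2)
  next
    case 1
    show ?case by (simp add: V_poly_def Q_poly_Suc_Suc Q_poly_0 Q_poly_Suc morgan_voyce_b_def algebra_simps)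
  next
    case (ge2 m)
    have "(x - 2) * V_poly (Suc (Suc m)) x = x * ((x - 2) * V_poly (Suc m) x) - (x - 2) * V_poly m x"
      by (simp add: V_poly_Suc_Suc algebra_simps)
    also have "\<dots> = Q_poly (Suc (Suc (Suc m))) (x - 2) - Q_poly (Suc (Suc m)) (x - 2)"
      unfolding ge2 by (simp add: Q_poly_Suc_Suc[of "Suc m"] Q_poly_Suc_Suc[of m] algebra_simps)
    finally show ?case .
  qed
  then show ?thesis using assms by (simp add: mult_P_poly[symmetric])
qed

section \<open>Cosine values\<close>

lemma phi_0: "phi m 0 = 2"
  by (simp add: phi_def)

lemma phi_mult: "phi m a * phi m b = phi m (a + b) + phi m (a - b)"
  by (simp add: phi_def cos_times_cos ring_distribs diff_divide_distrib add_divide_distrib)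

text \<open>The periodicity and the evenness of \<open>phi\<close> in one equation.\<close>
lemma phi_reflect: "phi m (int (2 * m + 1) * b - a) = phi m a"
proof -
  have nz: "2 * real m + 1 \<noteq> 0" by linarith
  have "2 * pi * of_int (int (2 * m + 1) * b - a) / (2 * of_nat m + 1)
      = 2 * pi * of_int b - 2 * pi * of_int a / (2 * of_nat m + 1)"
    using nz by (simp add: field_simps)
  then show ?thesis unfolding phi_def by (simp only: cos_diff cos_int_2pin sin_int_2pin) simp
qed

text \<open>The reason for the eigenvalues \<open>mu\<close>: a cosine sequence is an eigenvector of the second difference operator.\<close>
lemma phi_second_difference:
  "phi m ((j + 1) * t) - 2 * phi m (j * t) + phi m ((j - 1) * t) = mu m t * phi m (j * t)"
  using phi_mult[of m "j * t" t] by (simp add: mu_def algebra_simps)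

lemma mu_nonzero:
  assumes "1 \<le> t" "t \<le> m"
  shows "mu m (int t) \<noteq> 0"
proof
  assume "mu m (int t) = 0"
  then have "cos (2 * pi * real t / (2 * real m + 1)) = 1" by (simp add: mu_def phi_def)
  then obtain i :: int where "2 * pi * real t / (2 * real m + 1) = of_int i * 2 * pi"
    by (auto simp: cos_one_2pi_int)
  moreover have "2 * real m + 1 \<noteq> 0" by linarith
  ultimately have "(2 * pi) * real t = (2 * pi) * (of_int i * (2 * real m + 1))"
    by (simp only: nonzero_divide_eq_eq mult_ac)
  then have "real t = of_int i * (2 * real m + 1)" by (simp only: mult_cancel_left) simp
  then have "real_of_int (int t) = of_int (i * int (2 * m + 1))" by simp
  then have "int t = i * int (2 * m + 1)" by (simp only: of_int_eq_iff)
  then have "int (2 * m + 1) dvd int t" by simp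
  then have "2 * m + 1 dvd t" by (simp only: int_dvd_int_iff)
  then show False using assms by (auto dest: dvd_imp_le)
qed

text \<open>Each summand times \<open>sin x\<close> is a difference of consecutive sines, so the sum telescopes.\<close>
lemma Dirichlet_kernel:
  fixes x :: real
  shows "sin x * (1 + (\<Sum>t=1..M. 2 * cos (2 * real t * x))) = sin ((2 * real M + 1) * x)"
proof (induction M)
  case (Suc M)
  have "2 * sin x * cos (2 * real (Suc M) * x) = sin ((2 * real (Suc M) + 1) * x) - sin ((2 * real M + 1) * x)"
    using sin_times_cos[of x "2 * real (Suc M) * x"] sin_minus[of "x - 2 * real (Suc M) * x"]
    by (simp add: algebra_simps)
  then show ?case using Suc by (simp add: distrib_left)
qed simp

text \<open>This is the sum of \<open>\<zeta> ^ (a * t)\<close> over the nonzero residues \<open>t\<close>, where \<open>\<zeta>\<close> is a primitive root of unity of order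
\<open>2 * m + 1\<close>: conjugate terms are paired to \<open>phi\<close>, and the final \<open>- 1\<close> removes the unpaired term \<open>t = 0\<close>.\<close>
lemma sum_phi:
  "(\<Sum>t=1..m. phi m (a * int t)) = (if int (2 * m + 1) dvd a then 2 * real m + 1 else 0) - 1"
proof (cases "int (2 * m + 1) dvd a")
  case True
  then obtain b where b: "a = int (2 * m + 1) * b" by (rule dvdE)
  have "phi m (a * t) = 2" for t
    using phi_reflect[of m "b * t" 0] by (simp add: b phi_0 mult.assoc)
  then show ?thesis using True by simp
next
  case False
  define x where "x = pi * of_int a / (2 * real m + 1)"
  have nz: "2 * real m + 1 \<noteq> 0" by linarith
  have "sin x \<noteq> 0"
  proof
    assume "sin x = 0"
    then obtain i where "x = of_int i * pi" by (auto simp: sin_zero_iff_int2)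
    then have "pi * real_of_int a = pi * (of_int i * (2 * real m + 1))"
      using nz by (simp only: x_def nonzero_divide_eq_eq mult_ac)
    then have "real_of_int a = of_int i * (2 * real m + 1)" by (simp only: mult_cancel_left) simp
    then have "real_of_int a = of_int (i * int (2 * m + 1))" by simp
    then have "a = i * int (2 * m + 1)" by (simp only: of_int_eq_iff)
    then show False using False by simp
  qed
  moreover have "sin ((2 * real m + 1) * x) = 0"
    using nz by (simp add: x_def sin_zero_iff_int2)
  ultimately have "1 + (\<Sum>t=1..m. 2 * cos (2 * real t * x)) = 0"
    using Dirichlet_kernel[of x m] by simp
  moreover have "phi m (a * int t) = 2 * cos (2 * real t * x)" for t
    by (simp add: phi_def x_def algebra_simps)
  ultimately show ?thesis using False by simp
qed

text \<open>Since \<open>mu m t + 2 = phi m t\<close>, the recurrence of \<open>Q\<close> at \<open>mu\<close> is the product formula for \<open>phi m (j * t) * phi m t\<close>.\<close>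
lemma Q_poly_mu: "Q_poly j (mu m t) = phi m (int j * t)"
proof (induction j rule: induct_nat_012)
  case 0
  show ?case by (simp add: Q_poly_0 phi_0)
next
  case 1
  show ?case by (simp add: Q_poly_Suc morgan_voyce_b_def mu_def numeral_2_eq_2)
next
  case (ge2 j)
  have "phi m (int (Suc (Suc j)) * t) = (mu m t + 2) * phi m (int (Suc j) * t) - phi m (int j * t)"
    using phi_mult[of m "int (Suc j) * t" t] by (simp add: mu_def algebra_simps)
  then show ?case by (simp only: Q_poly_Suc_Suc ge2)
qed

lemma mult_P_poly_mu: "mu m t * P_poly j (mu m t) = phi m (int (Suc j) * t) - phi m (int j * t)"
  by (simp only: mult_P_poly Q_poly_mu)

text \<open>The multiples \<open>m * t\<close> and \<open>(m + 1) * t\<close> are opposite modulo \<open>2 * m + 1\<close>, so their cosines agree and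
\<open>mu * P\<close> vanishes.\<close>
lemma P_poly_mu_root:
  assumes "1 \<le> t" "t \<le> m"
  shows "P_poly m (mu m (int t)) = 0"
proof -
  have "phi m (int (Suc m) * int t) = phi m (int m * int t)"
    using phi_reflect[of m "int t" "int m * int t"] by (simp add: algebra_simps)
  then show ?thesis using mult_P_poly_mu[of m "int t" m] mu_nonzero[OF assms] by simp
qed

section \<open>Fleck numbers as cosine sums\<close>

text \<open>The residue class moves with \<open>r\<close> so that it stays centred at the middle of the binomial row; then the two
applications of Pascal's rule form a symmetric second difference. The extra \<open>1\<close> for \<open>r = 0\<close> is the contribution of the
frequency \<open>t = 0\<close>, where \<open>mu = 0\<close> and \<open>0 ^ 0 = 1\<close>.\<close>
lemma fleck_even_eq_sum:
  "real (2 * m + 1) * of_int (fleck (2 * r) (int r + j) (2 * m + 1))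
    = (if r = 0 then 1 else 0) + (\<Sum>t=1..m. mu m (int t) ^ r * phi m (j * int t))"
proof (induction r arbitrary: j)
  case 0
  show ?case using sum_phi[of m j] by (simp add: fleck_0)
next
  case (Suc r)
  let ?n = "2 * m + 1"
  let ?f = "\<lambda>j. real ?n * of_int (fleck (2 * r) (int r + j) ?n)"
  have "fleck (2 * Suc r) (int (Suc r) + j) ?n
      = fleck (2 * r) (int r + (j + 1)) ?n - 2 * fleck (2 * r) (int r + j) ?n
        + fleck (2 * r) (int r + (j - 1)) ?n"
  proof -
    have "2 * Suc r = Suc (Suc (2 * r))" "int (Suc r) + j = int r + (j + 1)"
      "int r + (j + 1) - 1 = int r + j" "int r + j - 1 = int r + (j - 1)" by simp_all
    then show ?thesis by (simp only: fleck_Suc)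
  qed
  then have "real ?n * of_int (fleck (2 * Suc r) (int (Suc r) + j) ?n)
      = ?f (j + 1) - 2 * ?f j + ?f (j - 1)"
    by (simp only: of_int_add of_int_diff of_int_mult of_int_numeral) (simp only: algebra_simps)
  also have "\<dots> = (\<Sum>t=1..m. mu m (int t) ^ r *
      (phi m ((j + 1) * int t) - 2 * phi m (j * int t) + phi m ((j - 1) * int t)))"
    by (simp only: Suc) (simp add: sum_subtractf sum.distrib sum_distrib_left algebra_simps)
  also have "\<dots> = (\<Sum>t=1..m. mu m (int t) ^ Suc r * phi m (j * int t))"
    by (simp only: phi_second_difference power_Suc2 mult.assoc)
  finally show ?case by simp
qed

text \<open>One application of Pascal's rule to the even case; the contributions of the frequency \<open>t = 0\<close> cancel.\<close>
lemma fleck_odd_eq_sum: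
  "real (2 * m + 1) * of_int (fleck (2 * r + 1) (int r + j) (2 * m + 1))
    = (\<Sum>t=1..m. mu m (int t) ^ r * (phi m (j * int t) - phi m ((j - 1) * int t)))"
proof -
  let ?n = "2 * m + 1"
  have "fleck (2 * r + 1) (int r + j) ?n
      = fleck (2 * r) (int r + j) ?n - fleck (2 * r) (int r + (j - 1)) ?n"
    using fleck_Suc[of "2 * r" "int r + j" ?n] by (simp add: algebra_simps)
  then have "real ?n * of_int (fleck (2 * r + 1) (int r + j) ?n)
     = real ?n * of_int (fleck (2 * r) (int r + j) ?n)
       - real ?n * of_int (fleck (2 * r) (int r + (j - 1)) ?n)"
    by (simp only: of_int_diff right_diff_distrib)
  then show ?thesis
    by (simp only: fleck_even_eq_sum right_diff_distrib sum_subtractf)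
qed

section \<open>Powers of the companion matrix\<close>

text \<open>A linear combination of the geometric sequences \<open>mu ^ r\<close> is annihilated by every polynomial in the shift that has all
\<open>mu\<close> as roots, here by \<open>P m\<close>. The computation takes place over the reals, where the \<open>mu\<close> live; the
coefficients of \<open>P m\<close> are integers, which carries the resulting identity over to the rationals.\<close>
lemma h_coeff_recurrence:
  fixes f :: "nat \<Rightarrow> int" and w :: "nat \<Rightarrow> real"
  assumes "\<And>r. real (2 * m + 1) * of_int (f r) = (\<Sum>t=1..m. mu m (int t) ^ r * w t)"
  shows "(\<Sum>k\<le>m. h_coeff m k * of_int (f (a + k))) = 0"
proof -
  define c where "c k = ((m + k + 1) choose (2 * k + 1)) + ((m + k) choose (2 * k + 1))" for k
  have "(\<Sum>k\<le>m. real (c k) * x ^ k) = P_poly m x" for x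
    unfolding P_poly_def P_coeff_eq c_def by (simp add: atMost_atLeast0)
  then have root: "(\<Sum>k\<le>m. real (c k) * mu m (int t) ^ k) = 0" if "t \<in> {1..m}" for t
    using that P_poly_mu_root by simp
  have "real (2 * m + 1) * (\<Sum>k\<le>m. real (c k) * of_int (f (a + k)))
      = (\<Sum>k\<le>m. real (c k) * (real (2 * m + 1) * of_int (f (a + k))))"
    by (simp only: sum_distrib_left mult.left_commute)
  also have "\<dots> = (\<Sum>k\<le>m. \<Sum>t=1..m. real (c k) * (mu m (int t) ^ (a + k) * w t))"
    by (simp only: assms sum_distrib_left)
  also have "\<dots> = (\<Sum>t=1..m. \<Sum>k\<le>m. real (c k) * (mu m (int t) ^ (a + k) * w t))"
    by (rule sum.swap)
  also have "\<dots> = (\<Sum>t=1..m. (mu m (int t) ^ a * w t) * (\<Sum>k\<le>m. real (c k) * mu m (int t) ^ k))"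
    by (simp only: sum_distrib_left power_add mult_ac)
  also have "\<dots> = 0" by (rule sum.neutral) (simp add: root)
  finally have "(\<Sum>k\<le>m. real (c k) * of_int (f (a + k))) = 0"
    by (simp del: of_nat_add of_nat_Suc of_nat_mult)
  then have "real_of_int (\<Sum>k\<le>m. int (c k) * f (a + k)) = 0" by simp
  then have int: "(\<Sum>k\<le>m. int (c k) * f (a + k)) = 0" by (simp only: of_int_eq_0_iff)
  have "(2 * of_nat m + 1) * h_coeff m k = of_nat (c k)" for k
    using P_coeff_eq[of m k, where 'a = rat] by (simp add: h_coeff_def c_def)
  then have "(2 * of_nat m + 1) * (\<Sum>k\<le>m. h_coeff m k * of_int (f (a + k)))
      = of_int (\<Sum>k\<le>m. int (c k) * f (a + k))"
    by (simp add: sum_distrib_left mult.assoc[symmetric])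
  moreover have "2 * of_nat m + 1 \<noteq> (0 :: rat)"
    by (metis of_nat_0_eq_iff of_nat_1 of_nat_add of_nat_mult of_nat_numeral
        add_is_0 one_neq_zero)
  ultimately show ?thesis unfolding int by simp
qed

text \<open>Let \<open>W a\<close> collect the windows of length \<open>m\<close> starting at \<open>a\<close>. Multiplying by \<open>R\<close> moves the windows one
place to the left: the superdiagonal of ones copies the entries that stay in sight, and the first column
computes the new entry \<open>u i a\<close> from the recurrence, where \<open>h 0 = 1\<close>. Hence the inverse of \<open>R\<close> moves them to the
right.\<close>
lemma window_matrix_times_R_power:
  fixes u :: "nat \<Rightarrow> nat \<Rightarrow> rat"
  assumes "m \<ge> 1"
    and rec: "\<And>i a. i < m \<Longrightarrow> (\<Sum>k\<le>m. h_coeff m k * u i (a + k)) = 0"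
  shows "mat m m (\<lambda>(i, k). u i k) * mat_powi (R_mat m) (- int r) = mat m m (\<lambda>(i, k). u i (r + k))"
proof -
  define W where "W a = mat m m (\<lambda>(i, k). u i (a + k))" for a
  have W: "W a \<in> carrier_mat m m" for a by (simp add: W_def)
  have R: "R_mat m \<in> carrier_mat m m" by (simp add: R_mat_def mat1_def)
  obtain S where S: "mat_inverse (R_mat m) = Some S" "S \<in> carrier_mat m m" "R_mat m * S = 1\<^sub>m m"
    using R_mat_inverse[OF assms(1)] by blast
  have WR: "W (Suc a) * R_mat m = W a" for a
  proof (rule eq_matI)
    fix i l assume "i < dim_row (W a)" "l < dim_col (W a)"
    then have il: "i < m" "l < m" by (simp_all add: W_def)
    have "(W (Suc a) * R_mat m) $$ (i, l)
       = (\<Sum>k=0..<m. u i (Suc a + k) * R_mat m $$ (k, l))"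
      using il R by (simp add: W_def scalar_prod_def)
    also have "\<dots> = u i (a + l)"
    proof (cases l)
      case 0
      have "h_coeff m 0 * u i a + (\<Sum>k=0..<m. h_coeff m (Suc k) * u i (a + Suc k)) = 0"
        using rec[OF il(1), of a] by (simp add: sum.atMost_shift atLeast0LessThan)
      moreover have "h_coeff m 0 = 1" by (simp add: h_coeff_def)
      moreover have "(\<Sum>k=0..<m. u i (Suc a + k) * R_mat m $$ (k, l))
          = - (\<Sum>k=0..<m. h_coeff m (Suc k) * u i (a + Suc k))"
        using il by (simp add: 0 R_mat_def mat1_def sum_negf[symmetric] mult.commute)
      ultimately show ?thesis using 0 by simp
    next
      case (Suc l')
      have "(\<Sum>k=0..<m. u i (Suc a + k) * R_mat m $$ (k, l))
          = (\<Sum>k=0..<m. if k = l' then u i (Suc a + k) else 0)"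
        using il by (intro sum.cong) (auto simp: Suc R_mat_def mat1_def)
      also have "\<dots> = u i (a + l)" using il Suc by simp
      finally show ?thesis .
    qed
    finally show "(W (Suc a) * R_mat m) $$ (i, l) = W a $$ (i, l)"
      using il by (simp add: W_def)
  qed (use R in \<open>simp_all add: W_def\<close>)
  have WS: "W a * S = W (Suc a)" for a
    using WR[of a] assoc_mult_mat[OF W[of "Suc a"] R S(2)] S(3) W[of "Suc a"] by simp
  have "W 0 * S ^\<^sub>m r = W r" for r
  proof (induction r)
    case 0
    show ?case using S(2) W[of 0] by simp
  next
    case (Suc r)
    have "W 0 * S ^\<^sub>m Suc r = (W 0 * S ^\<^sub>m r) * S"
      using assoc_mult_mat[OF W[of 0] pow_carrier_mat[OF S(2)] S(2)] by simp
    then show ?case by (simp add: Suc WS)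
  qed
  moreover have "mat_powi (R_mat m) (- int r) = S ^\<^sub>m r"
  proof (cases "r = 0")
    case True
    then show ?thesis using S R by (simp add: mat_powi_def)
  next
    case False
    then have "\<not> - int r \<ge> 0" by simp
    then show ?thesis by (simp only: mat_powi_def S(1) option.sel if_False minus_minus nat_int)
  qed
  ultimately show ?thesis by (simp add: W_def)
qed

text \<open>Each relevant Fleck number is the single term \<open>(2 * k + 1) choose (k + i + 1)\<close>, which is \<open>(2 * k + 1) choose (k - i)\<close> by
symmetry when \<open>i \<le> k\<close>; otherwise both sides vanish.\<close>
lemma B_odd_eq_fleck:
  "B_odd m = mat m m (\<lambda>(i, k). of_int (fleck (2 * k + 1) (int k + int (Suc i)) (2 * m + 1)))"
proof (rule eq_matI)
  fix i k assume "i < dim_row (mat m m (\<lambda>(i, k). of_int (fleck (2 * k + 1) (int k + int (Suc i)) (2 * m + 1))))"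
    "k < dim_col (mat m m (\<lambda>(i, k). of_int (fleck (2 * k + 1) (int k + int (Suc i)) (2 * m + 1))))"
  then have ik: "i < m" "k < m" by simp_all
  have "fleck (2 * k + 1) (int k + int (Suc i)) (2 * m + 1)
      = (-1) ^ (k + Suc i) * int ((2 * k + 1) choose (k + Suc i))"
    unfolding of_nat_add[symmetric] using ik by (intro fleck_single_term) auto
  moreover have "(2 * k + 1) choose (k + Suc i) = binom (2 * k + 1) (int k - int i)"
  proof (cases "i \<le> k")
    case True
    then have "(2 * k + 1) choose (k + Suc i) = (2 * k + 1) choose (k - i)"
      by (subst binomial_symmetric) simp_all
    then show ?thesis using True by (simp add: binom_def nat_diff_distrib)
  qed (simp add: binom_def)
  ultimately show "B_odd m $$ (i, k)
      = mat m m (\<lambda>(i, k). of_int (fleck (2 * k + 1) (int k + int (Suc i)) (2 * m + 1))) $$ (i, k)"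
    using ik by (simp add: B_odd_def mat1_def add.commute)
qed (simp_all add: B_odd_def mat1_def)

lemma B_even_eq_fleck:
  "B_even m = mat m m (\<lambda>(i, k). of_int (fleck (2 * k + 2) (int k + 1 + int (Suc i)) (2 * m + 1)))"
proof (rule eq_matI)
  fix i k assume "i < dim_row (mat m m (\<lambda>(i, k). of_int (fleck (2 * k + 2) (int k + 1 + int (Suc i)) (2 * m + 1))))"
    "k < dim_col (mat m m (\<lambda>(i, k). of_int (fleck (2 * k + 2) (int k + 1 + int (Suc i)) (2 * m + 1))))"
  then have ik: "i < m" "k < m" by simp_all
  have "int k + 1 + int (Suc i) = int (k + 1 + Suc i)" by simp
  then have "fleck (2 * k + 2) (int k + 1 + int (Suc i)) (2 * m + 1)
      = (-1) ^ (k + 1 + Suc i) * int ((2 * k + 2) choose (k + 1 + Suc i))"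
    using ik by (simp only:) (intro fleck_single_term, auto)
  moreover have "(2 * k + 2) choose (k + 1 + Suc i) = binom (2 * k + 2) (int k - int i)"
  proof (cases "i \<le> k")
    case True
    then have "(2 * k + 2) choose (k + 1 + Suc i) = (2 * k + 2) choose (k - i)"
      by (subst binomial_symmetric) simp_all
    then show ?thesis using True by (simp add: binom_def nat_diff_distrib)
  qed (simp add: binom_def)
  ultimately show "B_even m $$ (i, k)
      = mat m m (\<lambda>(i, k). of_int (fleck (2 * k + 2) (int k + 1 + int (Suc i)) (2 * m + 1))) $$ (i, k)"
    using ik by (simp add: B_even_def mat1_def add.commute)
qed (simp_all add: B_even_def mat1_def)

lemma F_seq_eq_fleck:
  assumes "1 \<le> j" "j \<le> m"
  shows "F_seq m j (- int r) = of_nat (2 * m + 1) * of_int (fleck (2 * r + 1) (int r + int j) (2 * m + 1))"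
proof -
  define u :: "nat \<Rightarrow> nat \<Rightarrow> rat"
    where "u i k = of_int (fleck (2 * k + 1) (int k + int (Suc i)) (2 * m + 1))" for i k
  have "(\<Sum>k\<le>m. h_coeff m k * u i (a + k)) = 0" for i a
    unfolding u_def by (rule h_coeff_recurrence, rule fleck_odd_eq_sum)
  moreover have "B_odd m = mat m m (\<lambda>(i, k). u i k)" by (simp only: B_odd_eq_fleck u_def)
  ultimately have "B_odd m * mat_powi (R_mat m) (- int r) = mat m m (\<lambda>(i, k). u i (r + k))"
    using assms by (simp only:) (rule window_matrix_times_R_power, auto)
  then show ?thesis using assms by (simp add: F_seq_def entry1_def u_def)
qed

lemma G_seq_eq_fleck:
  assumes "1 \<le> j" "j \<le> m"
  shows "G_seq m j (- int r) = of_nat (2 * m + 1) * of_int (fleck (2 * r + 2) (int r + 1 + int j) (2 * m + 1))"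
proof -
  define u :: "nat \<Rightarrow> nat \<Rightarrow> rat"
    where "u i k = of_int (fleck (2 * k + 2) (int k + 1 + int (Suc i)) (2 * m + 1))" for i k
  have "real (2 * m + 1) * of_int (fleck (2 * k + 2) (int k + 1 + i) (2 * m + 1))
      = (\<Sum>t=1..m. mu m (int t) ^ k * (mu m (int t) * phi m (i * int t)))" for k i
  proof -
    have eq: "int (Suc k) + i = int k + 1 + i" "2 * Suc k = 2 * k + 2" by simp_all
    show ?thesis
      using fleck_even_eq_sum[of m "Suc k" i] unfolding eq by (simp add: mult_ac)
  qed
  then have "(\<Sum>k\<le>m. h_coeff m k * u i (a + k)) = 0" for i a
    unfolding u_def by (rule h_coeff_recurrence)
  moreover have "B_even m = mat m m (\<lambda>(i, k). u i k)" by (simp only: B_even_eq_fleck u_def)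
  ultimately have "B_even m * mat_powi (R_mat m) (- int r) = mat m m (\<lambda>(i, k). u i (r + k))"
    using assms by (simp only:) (rule window_matrix_times_R_power, auto)
  moreover have "u (j - 1) r = of_int (fleck (2 * r + 2) (int r + 1 + int j) (2 * m + 1))"
    using assms(1) by (simp only: u_def Suc_diff_1)
  ultimately show ?thesis using assms by (simp add: G_seq_def entry1_def)
qed

section \<open>Weisman's congruence\<close>

text \<open>The additivity of the Frobenius map, expressed by divisibility in an arbitrary ring instead of an equation in
characteristic \<open>p\<close>, since powers of \<open>p\<close> are to be counted.\<close>
lemma prime_dvd_freshman:
  fixes a b :: "'a::comm_ring_1"
  assumes "prime p"
  shows "of_nat p dvd (a + b) ^ p - (a ^ p + b ^ p)"
proof -
  have p: "p > 0" using assms prime_gt_0_nat by blast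
  have "(a + b) ^ p = (\<Sum>k\<le>p. of_nat (p choose k) * a ^ k * b ^ (p - k))"
    by (rule binomial_ring)
  also have "{..p} = insert 0 (insert p {1..<p})" using p by auto
  also have "(\<Sum>k\<in>insert 0 (insert p {1..<p}). of_nat (p choose k) * a ^ k * b ^ (p - k))
      = b ^ p + (a ^ p + (\<Sum>k\<in>{1..<p}. of_nat (p choose k) * a ^ k * b ^ (p - k)))"
    using p by simp
  finally have expansion: "(a + b) ^ p - (a ^ p + b ^ p)
      = (\<Sum>k\<in>{1..<p}. of_nat (p choose k) * a ^ k * b ^ (p - k))" by simp
  have "of_nat p dvd (of_nat (p choose k) * a ^ k * b ^ (p - k) :: 'a)"
    if "k \<in> {1..<p}" for k
  proof -
    have "p dvd p choose k" using that assms by (intro dvd_choose_prime) auto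
    then obtain d where "p choose k = p * d" by (rule dvdE)
    then show ?thesis by (simp add: mult.assoc)
  qed
  then show ?thesis unfolding expansion by (rule dvd_sum)
qed

lemma dvd_power_diff:
  fixes u v d :: "'a::comm_ring_1"
  assumes "d dvd u - v"
  shows "d dvd u ^ k - v ^ k"
proof (cases k)
  case (Suc l)
  then show ?thesis using assms by (simp only: power_diff_sumr2 dvd_mult2)
qed simp

lemma dvd_diff_trans:
  fixes a b c d :: "'a::comm_ring_1"
  assumes "d dvd a - b" "d dvd b - c"
  shows "d dvd a - c"
  using dvd_add[OF assms] by simp

lemma prime_dvd_freshman_iterated:
  fixes a b :: "'a::comm_ring_1"
  assumes "prime p"
  shows "of_nat p dvd (a + b) ^ (p ^ e) - (a ^ (p ^ e) + b ^ (p ^ e))"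
proof (induction e)
  case (Suc e)
  let ?q = "p ^ e"
  have "of_nat p dvd ((a + b) ^ ?q) ^ p - (a ^ ?q + b ^ ?q) ^ p"
    by (rule dvd_power_diff[OF Suc])
  moreover have "of_nat p dvd (a ^ ?q + b ^ ?q) ^ p - ((a ^ ?q) ^ p + (b ^ ?q) ^ p)"
    by (rule prime_dvd_freshman[OF assms])
  ultimately have "of_nat p dvd ((a + b) ^ ?q) ^ p - ((a ^ ?q) ^ p + (b ^ ?q) ^ p)"
    by (rule dvd_diff_trans)
  then show ?case by (simp add: power_mult[symmetric] mult.commute)
qed simp

text \<open>Neighbouring entries of row \<open>p - 1\<close> add up to an inner entry of row \<open>p\<close>, so they are opposite modulo \<open>p\<close>.\<close>
lemma prime_dvd_choose_pred:
  assumes "prime p" "k < p"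
  shows "int p dvd int ((p - 1) choose k) - (-1) ^ k"
  using assms(2)
proof (induction k)
  case (Suc k)
  obtain l where l: "p = Suc l" using Suc.prems by (cases p) auto
  have "p dvd p choose Suc k" using Suc.prems assms(1) by (intro dvd_choose_prime) auto
  then have "int p dvd int (l choose Suc k) + int (l choose k)" unfolding l
    by (metis add.commute binomial_Suc_Suc of_nat_add of_nat_dvd_iff)
  moreover have "int p dvd int (l choose k) - (-1) ^ k" using Suc l by simp
  ultimately have "int p dvd (int (l choose Suc k) + int (l choose k)) - (int (l choose k) - (-1) ^ k)"
    by (rule dvd_diff)
  then show ?case using l by simp
qed simp

text \<open>All coefficients \<open>(-1) ^ k * ((p - 1) choose k)\<close> of \<open>(1 - y) ^ (p - 1)\<close> are \<open>1\<close> modulo \<open>p\<close>.\<close>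
lemma prime_dvd_power_minus_geometric:
  fixes y :: "'a::comm_ring_1"
  assumes "prime p"
  shows "of_nat p dvd (1 - y) ^ (p - 1) - (\<Sum>k<p. y ^ k)"
proof -
  have p: "p > 0" using assms prime_gt_0_nat by blast
  have "(1 - y) ^ (p - 1) = (\<Sum>k\<le>p - 1. of_nat ((p - 1) choose k) * (- y) ^ k * 1 ^ (p - 1 - k))"
    using binomial_ring[of "- y" 1 "p - 1"] by simp
  also have "{..p - 1} = {..<p}" using p by auto
  finally have "(1 - y) ^ (p - 1) - (\<Sum>k<p. y ^ k)
      = (\<Sum>k<p. of_nat ((p - 1) choose k) * (- y) ^ k - y ^ k)"
    by (simp add: sum_subtractf)
  also have "of_nat p dvd \<dots>"
  proof (rule dvd_sum)
    fix k assume "k \<in> {..<p}"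
    then obtain d where d: "int ((p - 1) choose k) - (-1) ^ k = int p * d"
      using prime_dvd_choose_pred[OF assms] by (auto elim: dvdE)
    have "of_nat ((p - 1) choose k) * (- y) ^ k - y ^ k
        = of_int (int ((p - 1) choose k) - (-1) ^ k) * (- y) ^ k"
    proof -
      have "y ^ k = (-1) ^ k * (- y) ^ k" by (simp add: power_mult_distrib[symmetric])
      then show ?thesis by (simp add: left_diff_distrib)
    qed
    then show "of_nat p dvd of_nat ((p - 1) choose k) * (- y) ^ k - y ^ k"
      unfolding d by (simp add: mult.assoc)
  qed
  finally show ?thesis .
qed

text \<open>This is membership in \<open>p ^ w * J + (x ^ (p * q) - 1)\<close>, where \<open>q = p ^ e\<close> and \<open>J = (1 - x ^ q, p)\<close>. Keeping the
result inside \<open>p ^ w * J\<close>, rather than only divisible by \<open>p ^ w\<close>, is what lets the induction on \<open>w\<close> continue.\<close>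
lemma one_minus_power_mod_prime_power:
  fixes x :: "'a::comm_ring_1"
  assumes p: "prime p" "odd p"
  shows "\<exists>A B C. (1 - x) ^ (p ^ e * (1 + w * (p - 1)))
    = of_nat p ^ w * ((1 - x ^ p ^ e) * A + of_nat p * B) + (x ^ (p ^ Suc e) - 1) * C"
proof -
  define q where "q = p ^ e"
  define y where "y = 1 - x ^ q"
  define u where "u = (1 - x) ^ q"
  define Z where "Z = x ^ (p ^ Suc e) - 1"
  define P where "P = (of_nat p :: 'a)"
  have "odd q" using p by (simp add: q_def)
  then have "P dvd u - y"
    using prime_dvd_freshman_iterated[OF p(1), of 1 "- x" e] by (simp add: u_def y_def q_def P_def)
  then obtain g where g: "u - y = P * g" by (rule dvdE)
  have u: "u = y + P * g" using g by (simp add: algebra_simps)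
  have "P dvd u ^ (p - 1) - y ^ (p - 1)" by (rule dvd_power_diff) (simp add: g)
  then obtain c where c: "u ^ (p - 1) - y ^ (p - 1) = P * c" by (rule dvdE)
  have uc: "u ^ (p - 1) = y ^ (p - 1) + P * c" using c by (simp add: algebra_simps)
  obtain h where h: "y ^ (p - 1) - (\<Sum>k<p. (x ^ q) ^ k) = P * h"
    using prime_dvd_power_minus_geometric[OF p(1), of "x ^ q"] unfolding y_def P_def by (rule dvdE)
  \<comment> \<open>The geometric sum is \<open>(x ^ (p * q) - 1) / (x ^ q - 1)\<close>, so \<open>y\<close> kills it modulo \<open>Z\<close>.\<close>
  have geo: "y * (\<Sum>k<p. (x ^ q) ^ k) = - Z"
    using one_diff_power_eq[of "x ^ q" p]
    by (simp add: y_def Z_def q_def power_mult[symmetric] mult.commute)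
  have "y * y ^ (p - 1) = y * (P * h + (\<Sum>k<p. (x ^ q) ^ k))"
    using h by (simp add: algebra_simps)
  then have yp: "y * y ^ (p - 1) = P * (y * h) - Z"
    using geo by (simp add: algebra_simps)
  have p2: "p - 1 = Suc (p - 2)" using prime_ge_2_nat[OF p(1)] by simp
  \<comment> \<open>Multiplication by \<open>u ^ (p - 1)\<close> maps \<open>J\<close> into \<open>p J\<close> modulo \<open>Z\<close>: on the generator \<open>y\<close>
    because \<open>u\<close> is \<open>y\<close> modulo \<open>p\<close>, on the generator \<open>p\<close> because \<open>u\<close> itself lies in \<open>J\<close>.\<close>
  have step: "u ^ (p - 1) * (y * A + P * B)
      = P * (y * (h * A + c * A + u ^ (p - 2) * B) + P * (g * u ^ (p - 2) * B)) + Z * (- A)" for A B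
  proof -
    have "u ^ (p - 1) * (y * A) = (y * y ^ (p - 1)) * A + P * c * y * A"
      by (subst uc) (simp only: algebra_simps)
    moreover have "u ^ (p - 1) * (P * B) = (y + P * g) * u ^ (p - 2) * (P * B)"
      by (simp only: p2 power_Suc u[symmetric])
    ultimately have "u ^ (p - 1) * (y * A + P * B)
       = (P * (y * h) - Z) * A + P * c * y * A + (y + P * g) * u ^ (p - 2) * (P * B)"
      by (simp only: yp distrib_left)
    also have "\<dots> = P * (y * (h * A + c * A + u ^ (p - 2) * B) + P * (g * u ^ (p - 2) * B)) + Z * (- A)"
      by (simp add: algebra_simps)
    finally show ?thesis .
  qed
  have "\<exists>A B C. u ^ (1 + w * (p - 1)) = P ^ w * (y * A + P * B) + Z * C"
  proof (induction w)
    case 0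
    show ?case by (rule exI[of _ 1], rule exI[of _ g], rule exI[of _ 0]) (simp add: u)
  next
    case (Suc w)
    then obtain A B C where IH: "u ^ (1 + w * (p - 1)) = P ^ w * (y * A + P * B) + Z * C" by blast
    have "u ^ (1 + Suc w * (p - 1)) = u ^ (p - 1) * u ^ (1 + w * (p - 1))"
    proof -
      have "1 + Suc w * (p - 1) = (p - 1) + (1 + w * (p - 1))" by simp
      then show ?thesis by (simp only: power_add)
    qed
    also have "\<dots> = P ^ w * (u ^ (p - 1) * (y * A + P * B)) + Z * (u ^ (p - 1) * C)"
      unfolding IH by (simp only: algebra_simps)
    also have "\<dots> = P ^ Suc w * (y * (h * A + c * A + u ^ (p - 2) * B) + P * (g * u ^ (p - 2) * B))
        + Z * (u ^ (p - 1) * C - P ^ w * A)"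
      unfolding step by (simp add: algebra_simps)
    finally show ?case by blast
  qed
  then show ?thesis by (simp only: u_def y_def Z_def P_def q_def power_mult)
qed

text \<open>With \<open>w\<close> the quotient in the exponent, \<open>N\<close> exceeds \<open>p ^ e * (1 + w * (p - 1))\<close> by a remainder \<open>s\<close>, and the
additional factor \<open>(1 - x) ^ s\<close> does no harm.\<close>
lemma Weisman_congruence:
  assumes p: "prime p" "odd p" and N: "p ^ e \<le> N"
  shows "int p ^ ((N - p ^ e) div (p ^ e * (p - 1))) dvd fleck N a (p ^ Suc e)"
proof -
  define w where "w = (N - p ^ e) div (p ^ e * (p - 1))"
  define s where "s = (N - p ^ e) mod (p ^ e * (p - 1))"
  have "N - p ^ e = w * (p ^ e * (p - 1)) + s" by (simp only: w_def s_def div_mult_mod_eq)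
  then have Neq: "N = p ^ e * (1 + w * (p - 1)) + s" using N by (simp add: algebra_simps)
  let ?X = "[:0, 1:] :: int poly"
  obtain A B C where ABC: "(1 - ?X) ^ (p ^ e * (1 + w * (p - 1)))
    = of_nat p ^ w * ((1 - ?X ^ p ^ e) * A + of_nat p * B) + (?X ^ (p ^ Suc e) - 1) * C"
    using one_minus_power_mod_prime_power[OF p] by blast
  define Y where "Y = ((1 - ?X ^ p ^ e) * A + of_nat p * B) * (1 - ?X) ^ s"
  have "(1 - ?X) ^ N = of_nat p ^ w * Y + (?X ^ (p ^ Suc e) - 1) * (C * (1 - ?X) ^ s)"
    unfolding Neq power_add ABC Y_def by (simp only: distrib_right mult.assoc)
  moreover have "of_nat p ^ w * Y = smult (int p ^ w) Y"
    by (simp add: of_nat_poly poly_const_pow)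
  ultimately have "fleck N a (p ^ Suc e) = int p ^ w * residue_sum (p ^ Suc e) a Y"
    by (simp only: fleck_eq_residue_sum residue_sum_add residue_sum_smult
        residue_sum_X_power_minus_one_mult add_0_right)
  then show ?thesis by (simp add: w_def)
qed

lemma floor_Weisman_exponent:
  assumes "1 \<le> p" "p ^ e \<le> N"
  shows "\<lfloor>(of_nat N - of_nat p ^ e) / (of_nat p ^ Suc e - of_nat p ^ e) :: rat\<rfloor>
    = int ((N - p ^ e) div (p ^ e * (p - 1)))"
proof -
  have "(of_nat N - of_nat p ^ e) / (of_nat p ^ Suc e - of_nat p ^ e)
      = (of_nat (N - p ^ e) / of_nat (p ^ e * (p - 1)) :: rat)"
    using assms by (simp add: of_nat_diff algebra_simps)
  then show ?thesis by (simp only: floor_divide_of_nat_eq)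
qed

text \<open>Since \<open>n > 1\<close>, the exponent \<open>\<alpha>\<close> is positive, so \<open>\<alpha> - 1\<close> is a true predecessor, and the floor of the rational
quotient is a quotient of natural numbers.\<close>
lemma Weisman_congruence_prime_power:
  assumes "prime p" "n = p ^ \<alpha>" "odd n" "n > 1" "p ^ (\<alpha> - 1) \<le> N"
    and "x = (of_nat n :: rat) * of_int (fleck N a n)"
  shows "\<exists>z::int. 1 / of_nat n * x = of_int z \<and>
    [z = 0] (mod int p ^ nat \<lfloor>(of_nat N - of_nat p ^ (\<alpha> - 1)) / (of_nat p ^ \<alpha> - of_nat p ^ (\<alpha> - 1)) :: rat\<rfloor>)"
proof -
  obtain e where e: "\<alpha> = Suc e" using assms(2,4) by (cases \<alpha>) auto
  have p: "odd p" using assms(2,3) by (simp add: e)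
  have N: "p ^ e \<le> N" using assms(5) by (simp add: e)
  have "p \<ge> 1" using assms(1) prime_ge_1_nat by blast
  then have exponent: "nat \<lfloor>(of_nat N - of_nat p ^ (\<alpha> - 1)) / (of_nat p ^ \<alpha> - of_nat p ^ (\<alpha> - 1)) :: rat\<rfloor>
      = (N - p ^ e) div (p ^ e * (p - 1))"
    using floor_Weisman_exponent[OF _ N] by (simp only: e diff_Suc_1 nat_int)
  have "1 / of_nat n * x = of_int (fleck N a n)" using assms(4,6) by simp
  moreover have "int p ^ ((N - p ^ e) div (p ^ e * (p - 1))) dvd fleck N a n"
    unfolding assms(2) e by (rule Weisman_congruence[OF assms(1) p N])
  ultimately show ?thesis unfolding exponent cong_0_iff by (intro exI[of _ "fleck N a n"] conjI)
qed

section \<open>The interlacing sequences and their congruences\<close>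

theorem theorem4:
  fixes r m n j :: nat
  assumes "m \<ge> 1" and "n = 2 * m + 1" and "1 \<le> j" and "j \<le> m"
  shows
    "F_seq m j (- int r) = of_nat n * Sum_any (\<lambda>a::int.
        (-1) powi (int r + int j + a) * of_nat (binom (2 * r + 1) (int r + int j + a * int n)))
     \<and> F_seq m j (- int r) = of_nat n * of_int (fleck (2 * r + 1) (int (r + j)) n)
     \<and> G_seq m j (- int r) = of_nat n * Sum_any (\<lambda>a::int.
        (-1) powi (int r + int j + 1 + a) * of_nat (binom (2 * r + 2) (int r + int j + 1 + a * int n)))
     \<and> G_seq m j (- int r) = of_nat n * of_int (fleck (2 * r + 2) (int (r + j + 1)) n)
     \<and> (\<forall>p \<alpha> :: nat. prime p \<and> n = p ^ \<alpha> \<longrightarrow>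
          (2 * r + 1 \<ge> p ^ (\<alpha> - 1) \<longrightarrow>
            (\<exists>z::int. 1 / of_nat n * F_seq m j (- int r) = of_int z \<and>
               [z = 0] (mod int p ^ nat \<lfloor>(2 * of_nat r + 1 - of_nat p ^ (\<alpha> - 1)) /
                                     (of_nat p ^ \<alpha> - of_nat p ^ (\<alpha> - 1)) :: rat\<rfloor>))) \<and>
          (2 * r + 2 \<ge> p ^ (\<alpha> - 1) \<longrightarrow>
            (\<exists>z::int. 1 / of_nat n * G_seq m j (- int r) = of_int z \<and>
               [z = 0] (mod int p ^ nat \<lfloor>(2 * of_nat r + 2 - of_nat p ^ (\<alpha> - 1)) /
                                     (of_nat p ^ \<alpha> - of_nat p ^ (\<alpha> - 1)) :: rat\<rfloor>))))
     \<and> real n * of_int (fleck (2 * r + 1) (int (r + j)) n)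
         = (\<Sum>t=1..m. mu m (int t) ^ (r + 1) * P_poly (j - 1) (mu m (int t)))
     \<and> real n * of_int (fleck (2 * r + 1) (int (r + j)) n)
         = (\<Sum>t=1..m. mu m (int t) ^ (r + 1) * V_poly (j - 1) (phi m (int t)))
     \<and> real n * of_int (fleck (2 * r + 1) (int (r + j)) n)
         = (\<Sum>t=1..m. mu m (int t) ^ r * (phi m (int (j * t)) - phi m (int ((j - 1) * t))))
     \<and> real n * of_int (fleck (2 * r + 2) (int (r + j + 1)) n)
         = (\<Sum>t=1..m. mu m (int t) ^ (r + 1) * Q_poly j (mu m (int t)))
     \<and> real n * of_int (fleck (2 * r + 2) (int (r + j + 1)) n)
         = (\<Sum>t=1..m. mu m (int t) ^ r *
              (phi m (int ((j + 1) * t)) - 2 * phi m (int (j * t)) + phi m (int ((j - 1) * t))))"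
proof -
  have n: "odd n" "n > 1" using assms(1,2) by simp_all
  have arg: "int (r + j) = int r + int j" "int (r + j + 1) = int r + 1 + int j"
    "int r + int j + 1 = int r + 1 + int j" by simp_all
  have F: "F_seq m j (- int r) = of_nat n * of_int (fleck (2 * r + 1) (int r + int j) n)"
    unfolding assms(2) by (rule F_seq_eq_fleck[OF assms(3,4)])
  have G: "G_seq m j (- int r) = of_nat n * of_int (fleck (2 * r + 2) (int r + 1 + int j) n)"
    unfolding assms(2) by (rule G_seq_eq_fleck[OF assms(3,4)])
  have congruences: "(2 * r + 1 \<ge> p ^ (\<alpha> - 1) \<longrightarrow>
        (\<exists>z::int. 1 / of_nat n * F_seq m j (- int r) = of_int z \<and>
           [z = 0] (mod int p ^ nat \<lfloor>(2 * of_nat r + 1 - of_nat p ^ (\<alpha> - 1)) /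
                                 (of_nat p ^ \<alpha> - of_nat p ^ (\<alpha> - 1)) :: rat\<rfloor>))) \<and>
      (2 * r + 2 \<ge> p ^ (\<alpha> - 1) \<longrightarrow>
        (\<exists>z::int. 1 / of_nat n * G_seq m j (- int r) = of_int z \<and>
           [z = 0] (mod int p ^ nat \<lfloor>(2 * of_nat r + 2 - of_nat p ^ (\<alpha> - 1)) /
                                 (of_nat p ^ \<alpha> - of_nat p ^ (\<alpha> - 1)) :: rat\<rfloor>)))"
    if p: "prime p" "n = p ^ \<alpha>" for p \<alpha> :: nat
  proof -
    have "of_nat (2 * r + 1) = (2 * of_nat r + 1 :: rat)"
      "of_nat (2 * r + 2) = (2 * of_nat r + 2 :: rat)" by simp_all
    then show ?thesis
      using Weisman_congruence_prime_power[OF p n, of "2 * r + 1", OF _ F]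
        Weisman_congruence_prime_power[OF p n, of "2 * r + 2", OF _ G]
      by (simp only:) blast
  qed
  let ?\<phi> = "\<lambda>k. phi m k" and ?\<mu> = "\<lambda>t. mu m (int t)"
  have odd_sum: "real n * of_int (fleck (2 * r + 1) (int r + int j) n)
      = (\<Sum>t=1..m. ?\<mu> t ^ r * (?\<phi> (int (j * t)) - ?\<phi> (int ((j - 1) * t))))"
    using fleck_odd_eq_sum[of m r "int j"] assms(2,3) by (simp add: of_nat_diff)
  have even_sum: "real n * of_int (fleck (2 * r + 2) (int r + 1 + int j) n)
      = (\<Sum>t=1..m. ?\<mu> t ^ (r + 1) * ?\<phi> (int j * int t))"
  proof -
    have eq: "int (Suc r) + int j = int r + 1 + int j" "2 * Suc r = 2 * r + 2" by simp_all
    show ?thesis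
      using fleck_even_eq_sum[of m "Suc r" "int j"] unfolding eq assms(2) by simp
  qed
  have P: "?\<mu> t ^ r * (?\<phi> (int (j * t)) - ?\<phi> (int ((j - 1) * t)))
      = ?\<mu> t ^ (r + 1) * P_poly (j - 1) (?\<mu> t)" for t
    using mult_P_poly_mu[of m "int t" "j - 1"] assms(3) by (simp add: mult.assoc mult.left_commute)
  \<comment> \<open>The index \<open>t\<close> is not a multiple of \<open>2 * m + 1\<close>, so \<open>phi\<close> is different from \<open>2\<close>.\<close>
  have V: "P_poly (j - 1) (?\<mu> t) = V_poly (j - 1) (?\<phi> (int t))" if "t \<in> {1..m}" for t
    using that mu_nonzero[of t m] V_poly_eq_P_poly[of "?\<phi> (int t)" "j - 1"] by (simp add: mu_def)
  have D: "?\<mu> t ^ (r + 1) * ?\<phi> (int j * int t)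
      = ?\<mu> t ^ r * (?\<phi> (int ((j + 1) * t)) - 2 * ?\<phi> (int (j * t)) + ?\<phi> (int ((j - 1) * t)))" for t
  proof -
    have eq: "int ((j + 1) * t) = (int j + 1) * int t" "int (j * t) = int j * int t"
      "int ((j - 1) * t) = (int j - 1) * int t" using assms(3) by (simp_all add: of_nat_diff algebra_simps)
    show ?thesis unfolding eq phi_second_difference by simp
  qed
  have odd_P: "real n * of_int (fleck (2 * r + 1) (int r + int j) n)
      = (\<Sum>t=1..m. ?\<mu> t ^ (r + 1) * P_poly (j - 1) (?\<mu> t))"
    unfolding odd_sum P ..
  moreover have "\<dots> = (\<Sum>t=1..m. ?\<mu> t ^ (r + 1) * V_poly (j - 1) (?\<phi> (int t)))"
    by (rule sum.cong) (simp_all only: V)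
  ultimately have odd_V: "real n * of_int (fleck (2 * r + 1) (int r + int j) n)
      = (\<Sum>t=1..m. ?\<mu> t ^ (r + 1) * V_poly (j - 1) (?\<phi> (int t)))"
    by (rule trans)
  have even_Q: "real n * of_int (fleck (2 * r + 2) (int r + 1 + int j) n)
      = (\<Sum>t=1..m. ?\<mu> t ^ (r + 1) * Q_poly j (?\<mu> t))"
    by (simp only: even_sum Q_poly_mu)
  show ?thesis
    unfolding arg Sum_any_binom_eq_fleck[OF n(1)]
    using F G congruences odd_P odd_V odd_sum even_Q even_sum[unfolded D]
    by (intro conjI allI impI) (simp_all only:)
qed

end
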